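(* Let $m\ge 1$, let $a_1,\dots,a_m$ be distinct non-negative integers, $I_i=[a_i,a_i+1)$, $\Omega=\bigcup_{i=1}^m I_i$, and let $\mathbf N=(N_1,\dots,N_m)\in\mathbb N^m$ (positive integers) be allowable for $\Omega$. Let $T:\Omega\to\Omega$ be the associated alternating $N$-expansion map. Then for every $x\in\Omega$ with $T^n(x)\neq 0$ for all $n\ge 0$, the convergents $p_n/q_n$ of $x$ satisfy $$\lim_{n\to\infty}\frac{p_n}{q_n}=x,$$ that is, $$x=\cfrac{N_{j(x)}}{d_1(x)+\cfrac{N_{j(T(x))}}{d_2(x)+\cfrac{N_{j(T^2(x))}}{\ddots}}}.$$
   Context: For $x\in\Omega$ let $j(x)=i$ when $x\in I_i$, and $k(x)=(j(x)\bmod m)+1$ (the cyclically next index). The map $T:\Omega\to\Omega$ is $$T(x)=\frac{N_{j(x)}}{x}-\left\lfloor\frac{N_{j(x)}}{x}\right\rfloor+a_{k(x)}\quad (x\ne 0),$$ and $T(0)=0$ if $0\in\Omega$. The vector $\mathbf N$ is called allowable for $\Omega$ if $\left\lfloor N_{j(x)}/x\right\rfloor-a_{k(x)}>0$ for all $x\in\Omega$, $x\neq0$. The digits are $d_1(x)=\left\lfloor N_{j(x)}/x\right\rfloor-a_{k(x)}$ and $d_n(x)=d_1(T^{n-1}(x))$, so $T(x)=N_{j(x)}/x-d_1(x)$. For fixed $x$ put $M_n:=N_{j(T^{n-1}(x))}$ and $d_n=d_n(x)$. The convergents $p_n/q_n$ of $x$ are defined by $$p_{-1}=1,\ p_0=0,\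 p_n=d_np_{n-1}+M_np_{n-2};\qquad q_{-1}=0,\ q_0=1,\ q_n=d_nq_{n-1}+M_nq_{n-2}\quad(n\ge1).$$ *)

theory Defs
  imports "HOL-Analysis.Analysis"
begin

definition unit_interval :: "(nat \<Rightarrow> nat) \<Rightarrow> nat \<Rightarrow> real set" where
  "unit_interval a i = {real (a i)..<real (a i) + 1}"

definition Omega :: "nat \<Rightarrow> (nat \<Rightarrow> nat) \<Rightarrow> real set" where
  "Omega m a = (\<Union>i\<in>{1..m}. unit_interval a i)"

text \<open>Indices run over \<open>{1..m}\<close>; the values of \<open>a\<close> and \<open>N\<close> elsewhere are never used.
  The index \<open>j(x)\<close> is meaningful only for \<open>x\<close> in \<open>Omega m a\<close> and distinct \<open>a 1, \<dots>, a m\<close>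
  (see \<open>index_of_eq\<close> below).\<close>

definition index_of :: "nat \<Rightarrow> (nat \<Rightarrow> nat) \<Rightarrow> real \<Rightarrow> nat" where
  "index_of m a x = (THE i. i \<in> {1..m} \<and> x \<in> unit_interval a i)"

definition next_index :: "nat \<Rightarrow> (nat \<Rightarrow> nat) \<Rightarrow> real \<Rightarrow> nat" where
  "next_index m a x = index_of m a x mod m + 1"

definition alt_map :: "nat \<Rightarrow> (nat \<Rightarrow> nat) \<Rightarrow> (nat \<Rightarrow> nat) \<Rightarrow> real \<Rightarrow> real" where
  "alt_map m a N x =
     (if x = 0 then 0
      else real (N (index_of m a x)) / x - of_int \<lfloor>real (N (index_of m a x)) / x\<rfloor>
           + real (a (next_index m a x)))"

definition first_digit :: "nat \<Rightarrow> (nat \<Rightarrow> nat) \<Rightarrow> (nat \<Rightarrow> nat) \<Rightarrow> real \<Rightarrow> int" where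
  "first_digit m a N x = \<lfloor>real (N (index_of m a x)) / x\<rfloor> - int (a (next_index m a x))"

definition allowable :: "nat \<Rightarrow> (nat \<Rightarrow> nat) \<Rightarrow> (nat \<Rightarrow> nat) \<Rightarrow> bool" where
  "allowable m a N \<longleftrightarrow>
     (\<forall>x\<in>Omega m a. x \<noteq> 0 \<longrightarrow>
        \<lfloor>real (N (index_of m a x)) / x\<rfloor> - int (a (next_index m a x)) > 0)"

text \<open>The sequences \<open>d\<^sub>n\<close> and \<open>M\<^sub>n\<close> are indexed from \<open>n = 1\<close>.\<close>

definition digit :: "nat \<Rightarrow> (nat \<Rightarrow> nat) \<Rightarrow> (nat \<Rightarrow> nat) \<Rightarrow> real \<Rightarrow> nat \<Rightarrow> int" where
  "digit m a N x n = first_digit m a N ((alt_map m a N ^^ (n - 1)) x)"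

definition numer :: "nat \<Rightarrow> (nat \<Rightarrow> nat) \<Rightarrow> (nat \<Rightarrow> nat) \<Rightarrow> real \<Rightarrow> nat \<Rightarrow> nat" where
  "numer m a N x n = N (index_of m a ((alt_map m a N ^^ (n - 1)) x))"

text \<open>The recursions start at index \<open>-1\<close>, hence a shift by one: \<open>p_shift d M n\<close> is \<open>p\<^sub>n\<^sub>-\<^sub>1\<close>
  and \<open>q_shift d M n\<close> is \<open>q\<^sub>n\<^sub>-\<^sub>1\<close>.\<close>

fun p_shift :: "(nat \<Rightarrow> int) \<Rightarrow> (nat \<Rightarrow> nat) \<Rightarrow> nat \<Rightarrow> int" where
  "p_shift d M 0 = 1"
| "p_shift d M (Suc 0) = 0"
| "p_shift d M (Suc (Suc n)) =
     d (Suc n) * p_shift d M (Suc n) + int (M (Suc n)) * p_shift d M n"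

fun q_shift :: "(nat \<Rightarrow> int) \<Rightarrow> (nat \<Rightarrow> nat) \<Rightarrow> nat \<Rightarrow> int" where
  "q_shift d M 0 = 0"
| "q_shift d M (Suc 0) = 1"
| "q_shift d M (Suc (Suc n)) =
     d (Suc n) * q_shift d M (Suc n) + int (M (Suc n)) * q_shift d M n"

definition conv_p :: "nat \<Rightarrow> (nat \<Rightarrow> nat) \<Rightarrow> (nat \<Rightarrow> nat) \<Rightarrow> real \<Rightarrow> nat \<Rightarrow> int" where
  "conv_p m a N x n = p_shift (digit m a N x) (numer m a N x) (Suc n)"

definition conv_q :: "nat \<Rightarrow> (nat \<Rightarrow> nat) \<Rightarrow> (nat \<Rightarrow> nat) \<Rightarrow> real \<Rightarrow> nat \<Rightarrow> int" where
  "conv_q m a N x n = q_shift (digit m a N x) (numer m a N x) (Suc n)"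

text \<open>\<open>cfrac_trunc d M k n\<close> is the \<open>n\<close>-level fraction
  \<open>M\<^sub>k / (d\<^sub>k + M\<^sub>k\<^sub>+\<^sub>1 / (d\<^sub>k\<^sub>+\<^sub>1 + \<dots> + M\<^sub>k\<^sub>+\<^sub>n\<^sub>-\<^sub>1 / d\<^sub>k\<^sub>+\<^sub>n\<^sub>-\<^sub>1))\<close>. An infinite continued fraction
  has value \<open>x\<close> when its truncations converge to \<open>x\<close>.\<close>

fun cfrac_trunc :: "(nat \<Rightarrow> int) \<Rightarrow> (nat \<Rightarrow> nat) \<Rightarrow> nat \<Rightarrow> nat \<Rightarrow> real" where
  "cfrac_trunc d M k 0 = 0"
| "cfrac_trunc d M k (Suc n) = real (M k) / (of_int (d k) + cfrac_trunc d M (Suc k) n)"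

definition has_cfrac_value :: "(nat \<Rightarrow> int) \<Rightarrow> (nat \<Rightarrow> nat) \<Rightarrow> real \<Rightarrow> bool" where
  "has_cfrac_value d M x \<longleftrightarrow> (\<lambda>n. cfrac_trunc d M 1 n) \<longlonglongrightarrow> x"

lemma index_of_eq:
  assumes "inj_on a {1..m}" "i \<in> {1..m}" "x \<in> unit_interval a i"
  shows "index_of m a x = i"
  unfolding index_of_def
proof (rule the_equality)
  fix i' assume i': "i' \<in> {1..m} \<and> x \<in> unit_interval a i'"
  with assms(3) have "real (a i') < real (a i) + 1" "real (a i) < real (a i') + 1"
    by (auto simp: unit_interval_def)
  then have "a i' = a i" by linarith
  with assms(1,2) i' show "i' = i" by (auto dest: inj_onD)
qed (use assms in auto)

lemma alt_map_in_Omega: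
  assumes "m \<ge> 1" "x \<in> Omega m a"
  shows "alt_map m a N x \<in> Omega m a"
proof (cases "x = 0")
  case True
  then show ?thesis using assms by (simp add: alt_map_def)
next
  case False
  have "next_index m a x \<in> {1..m}"
    using assms(1) mod_less_divisor[of m "index_of m a x"] by (simp add: next_index_def Suc_le_eq)
  moreover have "alt_map m a N x \<in> unit_interval a (next_index m a x)"
    using False by (simp add: alt_map_def unit_interval_def) linarith
  ultimately show ?thesis unfolding Omega_def by blast
qed

end

(* Write t n for the n-th iterate of x. Then x * q n - p n = - t n * (x * q (n - 1) - p (n - 1)),
   while t (n + 1) * t (n + 2) = M (n + 2) - d (n + 2) * t (n + 1) < M (n + 2). As all digits are at
   least 1, q is nondecreasing and q (n + 2) >= (1 + M (n + 2)) * q n. The numerators M n take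
   finitely many values, at most B say, so the error abs (x - p n / q n) shrinks at least by the
   factor B / (B + 1) every two steps. *)

theory Submission
  imports Defs
begin

text \<open>The recursion looks back two terms, so the induction carries two consecutive ones; the
  earlier is only nonnegative, since the sequence starts from 0.\<close>

lemma q_shift_pos:
  assumes "\<And>n. n \<ge> 1 \<Longrightarrow> d n \<ge> 1"
  shows "0 \<le> q_shift d M n \<and> 0 < q_shift d M (Suc n)"
proof (induction n)
  case (Suc n)
  have "d (Suc n) \<ge> 1" using assms by simp
  then have "0 < d (Suc n) * q_shift d M (Suc n)" using Suc by simp
  then show ?case using Suc by (simp add: add_pos_nonneg)
qed simp

lemma q_shift_mono:
  assumes "\<And>n. n \<ge> 1 \<Longrightarrow> d n \<ge> 1"
  shows "q_shift d M n \<le> q_shift d M (Suc n)"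
proof (cases n)
  case (Suc k)
  have "d (Suc k) \<ge> 1" using assms by simp
  then have "1 * q_shift d M (Suc k) \<le> d (Suc k) * q_shift d M (Suc k)"
    using q_shift_pos[of d, OF assms] by (intro mult_right_mono) auto
  then show ?thesis
    using q_shift_pos[of d, OF assms] Suc by (simp add: add_increasing2)
qed simp

text \<open>The defining recursions append a digit at the end, whereas a continued fraction nests
  from the front. Peeling off the first digit instead turns the tail quotient \<open>p / q\<close>
  into \<open>M 1 / (d 1 + p / q)\<close>.\<close>

lemma p_q_shift_Suc:
  "p_shift d M (Suc n) = int (M 1) * q_shift (d \<circ> Suc) (M \<circ> Suc) n"
  "q_shift d M (Suc n) =
     d 1 * q_shift (d \<circ> Suc) (M \<circ> Suc) n + p_shift (d \<circ> Suc) (M \<circ> Suc) n"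
  by (induction d M n rule: p_shift.induct) (simp_all add: algebra_simps)

text \<open>Trades a later starting index for shifted sequences, the form in which the front
  recursion describes the tail.\<close>

lemma cfrac_trunc_Suc: "cfrac_trunc d M (Suc k) n = cfrac_trunc (d \<circ> Suc) (M \<circ> Suc) k n"
  by (induction n arbitrary: k) auto

lemma cfrac_trunc_eq_convergent:
  assumes "\<And>n. n \<ge> 1 \<Longrightarrow> d n \<ge> 1"
  shows "cfrac_trunc d M 1 n = of_int (p_shift d M (Suc n)) / of_int (q_shift d M (Suc n))"
  using assms
proof (induction n arbitrary: d M)
  case (Suc n)
  let ?d = "d \<circ> Suc" and ?M = "M \<circ> Suc"
  have d: "\<And>n. n \<ge> 1 \<Longrightarrow> ?d n \<ge> 1" using Suc.prems by simp
  have q: "q_shift ?d ?M (Suc n) > 0" using q_shift_pos[of ?d, OF d] by blast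
  have "cfrac_trunc d M 1 (Suc n) =
      M 1 / (d 1 + p_shift ?d ?M (Suc n) / q_shift ?d ?M (Suc n))"
    by (simp only: cfrac_trunc.simps(2) One_nat_def[symmetric] cfrac_trunc_Suc[where k = 1]
        Suc.IH[of ?d ?M, OF d])
  also have "\<dots> = M 1 * q_shift ?d ?M (Suc n) /
      (d 1 * q_shift ?d ?M (Suc n) + p_shift ?d ?M (Suc n))"
    using q by (simp add: field_simps)
  also have "\<dots> = p_shift d M (Suc (Suc n)) / q_shift d M (Suc (Suc n))"
    by (simp only: p_q_shift_Suc[of d M "Suc n"] of_int_add of_int_mult of_int_of_nat_eq)
  finally show ?case .
qed simp

lemma tendsto_zero_two_step_contraction:
  fixes u :: "nat \<Rightarrow> real"
  assumes "0 \<le> r" "r < 1" "\<And>n. 0 \<le> u n" "\<And>n. u (Suc (Suc n)) \<le> r * u n"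
  shows "u \<longlonglongrightarrow> 0"
proof -
  \<comment> \<open>Even and odd indices contract separately; \<open>u 0 + u 1\<close> dominates
    both starting values.\<close>
  have bound: "u n \<le> r ^ (n div 2) * (u 0 + u 1)" for n
  proof (induction n rule: induct_nat_012)
    case (ge2 n)
    have "u (Suc (Suc n)) \<le> r * u n" by (rule assms(4))
    also have "\<dots> \<le> r * (r ^ (n div 2) * (u 0 + u 1))"
      using ge2(1) assms(1) by (rule mult_left_mono)
    finally show ?case by (simp add: mult.assoc)
  qed (use assms(3)[of 0] assms(3)[of 1] in auto)
  have "filterlim (\<lambda>n. n div 2) sequentially (sequentially :: nat filter)"
    unfolding filterlim_at_top
  proof
    show "\<forall>\<^sub>F n in sequentially. k \<le> n div 2" for k :: nat
      using eventually_ge_at_top[of "2 * k"] by eventually_elim linarith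
  qed
  then have "(\<lambda>n. r ^ (n div 2)) \<longlonglongrightarrow> 0"
    by (rule filterlim_compose[rotated]) (use assms(1,2) in \<open>simp add: LIMSEQ_power_zero\<close>)
  then have "(\<lambda>n. r ^ (n div 2) * (u 0 + u 1)) \<longlonglongrightarrow> 0"
    by (rule tendsto_mult_left_zero)
  then show ?thesis
    by (rule tendsto_sandwich[OF _ _ tendsto_const, rotated 2]) (use assms(3) bound in auto)
qed

text \<open>The orbit enters only through \<open>t n = M (Suc n) / (d (Suc n) + t (Suc n))\<close>,
  written without division.\<close>

lemma convergents_tendsto:
  fixes t :: "nat \<Rightarrow> real" and d :: "nat \<Rightarrow> int" and M :: "nat \<Rightarrow> nat"
  assumes d: "\<And>n. n \<ge> 1 \<Longrightarrow> d n \<ge> 1"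
    and M: "\<And>n. n \<ge> 1 \<Longrightarrow> M n \<le> B"
    and t_pos: "\<And>n. t n > 0"
    and t_Suc: "\<And>n. t n * (d (Suc n) + t (Suc n)) = M (Suc n)"
  shows "(\<lambda>n. of_int (p_shift d M (Suc n)) / of_int (q_shift d M (Suc n))) \<longlonglongrightarrow> t 0"
proof -
  define p q :: "nat \<Rightarrow> real"
    where "p n = p_shift d M (Suc n)" and "q n = q_shift d M (Suc n)" for n
  have q_pos: "q n > 0" for n using q_shift_pos[of d, OF d] by (simp add: q_def)
  have q_mono: "q n \<le> q (Suc n)" for n unfolding q_def of_int_le_iff using d by (rule q_shift_mono)
  have p_rec: "p (Suc (Suc n)) = d (n + 2) * p (Suc n) + M (n + 2) * p n"
    and q_rec: "q (Suc (Suc n)) = d (n + 2) * q (Suc n) + M (n + 2) * q n" for n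
    by (simp_all add: p_def q_def numeral_2_eq_2)
  have t_rec: "t (Suc n) * d (n + 2) = M (n + 2) - t (Suc n) * t (n + 2)" for n
    using t_Suc[of "Suc n"] by (simp add: algebra_simps numeral_2_eq_2)
  \<comment> \<open>The error scaled by \<open>q n\<close>: it obeys the same linear recurrence as
    \<open>p\<close> and \<open>q\<close>.\<close>
  define e where "e n = t 0 * q n - p n" for n
  have e_Suc: "e (Suc n) = - t (Suc n) * e n" for n
  proof (induction n)
    case 0
    show ?case using t_Suc[of 0] by (simp add: e_def p_def q_def algebra_simps)
  next
    case (Suc n)
    have "e (Suc (Suc n)) = d (n + 2) * e (Suc n) + M (n + 2) * e n"
      unfolding e_def p_rec q_rec by (simp add: algebra_simps)
    also have "\<dots> = - (t (Suc n) * d (n + 2)) * e n + M (n + 2) * e n"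
      unfolding Suc by simp
    also have "\<dots> = - t (n + 2) * e (Suc n)"
      unfolding t_rec Suc by (simp add: algebra_simps)
    finally show ?case by (simp add: numeral_2_eq_2)
  qed
  define u where "u n = \<bar>e n\<bar> / q n" for n
  \<comment> \<open>M/(1+M) increases with M, so its value at \<open>B\<close> bounds the
    contraction factor for every \<open>n\<close>.\<close>
  define r where "r = real B / (real B + 1)"
  have "u (Suc (Suc n)) \<le> r * u n" for n
  proof -
    let ?M = "real (M (n + 2))" and ?d = "real_of_int (d (n + 2))"
    have M_le: "?M \<le> real B" using M[of "n + 2"] by simp
    have d_ge: "1 \<le> ?d" using d[of "n + 2"] by simp
    have "q n \<le> ?d * q (Suc n)"
      using mult_mono[OF d_ge q_mono[of n]] q_pos[of n] d_ge by simp
    \<comment> \<open>Together with the next inequality this is M/(1+M) \<le> B/(B+1) with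
      denominators cleared.\<close>
    then have "real B * q n * (1 + ?M) \<le> real B * (?d * q (Suc n) + ?M * q n)"
      unfolding mult.assoc by (intro mult_left_mono) (simp_all add: algebra_simps)
    moreover have "?M * q n \<le> real B * q n" using M_le q_pos[of n] by simp
    ultimately have "?M * q n * (real B + 1) \<le> real B * q (Suc (Suc n))"
      unfolding q_rec by (simp add: algebra_simps)
    then have ratio: "?M / q (Suc (Suc n)) \<le> r / q n"
      using q_pos[of n] q_pos[of "Suc (Suc n)"] mult_pos_pos[of "real B + 1" "q n"]
      by (simp add: r_def pos_divide_le_eq pos_le_divide_eq mult_ac)
    \<comment> \<open>A single factor \<open>t\<close> may exceed 1 and enlarge \<open>e\<close>;
      only the product of two consecutive factors is controlled.\<close>
    have "t (n + 2) * t (Suc n) \<le> ?M"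
      using t_rec[of n] mult_nonneg_nonneg[of "t (Suc n)" ?d] t_pos[of "Suc n"] d_ge
      by (simp add: mult.commute)
    then have "\<bar>e (Suc (Suc n))\<bar> \<le> ?M * \<bar>e n\<bar>"
      using t_pos[of "Suc n"] t_pos[of "n + 2"]
      by (simp add: e_Suc abs_mult mult.assoc[symmetric] mult_right_mono)
    then have "u (Suc (Suc n)) \<le> ?M / q (Suc (Suc n)) * \<bar>e n\<bar>"
      using q_pos[of "Suc (Suc n)"] by (simp add: u_def divide_right_mono)
    also have "\<dots> \<le> r / q n * \<bar>e n\<bar>" using ratio by (intro mult_right_mono) auto
    finally show ?thesis by (simp add: u_def)
  qed
  then have "u \<longlonglongrightarrow> 0"
    using q_pos by (intro tendsto_zero_two_step_contraction[of r])
      (auto simp: r_def u_def less_imp_le)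
  moreover have "u = (\<lambda>n. \<bar>p n / q n - t 0\<bar>)"
  proof
    fix n
    have "p n / q n - t 0 = - e n / q n" using q_pos[of n] by (simp add: e_def field_simps)
    then show "u n = \<bar>p n / q n - t 0\<bar>" using q_pos[of n] by (simp add: u_def abs_divide)
  qed
  ultimately have "(\<lambda>n. p n / q n - t 0) \<longlonglongrightarrow> 0"
    using tendsto_rabs_zero_iff[of "\<lambda>n. p n / q n - t 0" sequentially] by simp
  then show ?thesis unfolding p_def q_def by (rule LIM_zero_cancel)
qed

theorem mainTheorem1:
  fixes m :: nat and a N :: "nat \<Rightarrow> nat" and x :: real
  assumes "m \<ge> 1"
    and "inj_on a {1..m}"
    and "\<forall>i\<in>{1..m}. N i > 0"
    and "allowable m a N"
    and "x \<in> Omega m a"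
    and "\<forall>n. (alt_map m a N ^^ n) x \<noteq> 0"
  shows "(\<lambda>n. real_of_int (conv_p m a N x n) / real_of_int (conv_q m a N x n)) \<longlonglongrightarrow> x
       \<and> has_cfrac_value (digit m a N x) (numer m a N x) x"
proof -
  define t where "t n = (alt_map m a N ^^ n) x" for n
  let ?d = "digit m a N x" and ?M = "numer m a N x"
  have t_in: "t n \<in> Omega m a" for n
    unfolding t_def by (induction n) (use assms(1,5) alt_map_in_Omega in \<open>auto simp del: One_nat_def\<close>)
  have t_nz: "t n \<noteq> 0" for n using assms(6) by (simp add: t_def)
  have t_pos: "t n > 0" for n
    using t_in[of n] t_nz[of n] by (fastforce simp: Omega_def unit_interval_def)
  \<comment> \<open>Also covers \<open>n = 0\<close>: truncated subtraction makes digit 0 equal to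
    digit 1.\<close>
  have d: "?d n \<ge> 1" for n
    using assms(4) t_in[of "n - 1"] t_nz[of "n - 1"]
    by (auto simp: allowable_def digit_def first_digit_def t_def)
  have index_in: "index_of m a (t n) \<in> {1..m}" for n
    using t_in[of n] index_of_eq[OF assms(2)] by (auto simp: Omega_def)
  have M: "?M n \<le> Max (N ` {1..m})" for n
    unfolding numer_def t_def[symmetric] by (intro Max_ge) (use index_in in auto)
  \<comment> \<open>In digit plus next iterate, the floor and the added \<open>a\<close> value
    cancel, leaving \<open>?M (Suc n) / t n\<close>.\<close>
  have t_Suc: "t n * (?d (Suc n) + t (Suc n)) = ?M (Suc n)" for n
    using t_nz[of n]
    by (simp add: alt_map_def digit_def first_digit_def numer_def t_def)
  have lim: "(\<lambda>n. p_shift ?d ?M (Suc n) / q_shift ?d ?M (Suc n)) \<longlonglongrightarrow> x"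
    using convergents_tendsto[of ?d ?M "Max (N ` {1..m})" t, OF d M t_pos t_Suc]
    by (simp add: t_def)
  \<comment> \<open>Truncations equal convergents, so both conjuncts reduce to
    \<open>lim\<close>.\<close>
  then show ?thesis
    unfolding conv_p_def conv_q_def has_cfrac_value_def cfrac_trunc_eq_convergent[of ?d, OF d]
    by simp
qed

end
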